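(* Let $k,n$ be integers with $2\le n\le k$. When $A\to0$, the method EFCM($k,n$) for $u'+Au=g(t,u)$, $u(0)=u_0$, reduces to $$v_i=u_0+c_ih\sum_{l=1}^{k}b_l\Big(\sum_{j=0}^{n-1}\tilde I_{j,c_i}\widehat P_j(c_l)\Big)g(c_lh,v_l),\quad i=1,\dots,k,\qquad v(h)=u_0+h\sum_{l=1}^{k}b_l\,g(c_lh,v_l),$$ where $\tilde I_{j,c_i}=\int_0^1\widehat P_j(c_iz)\,dz$; that is, the coefficients of EFCM($k,n$) tend to the coefficients of this scheme as $A\to 0$. This scheme can be rewritten as the $k$-stage Runge–Kutta method with nodes $c_1,\dots,c_k$, weights $b_1,\dots,b_k$ and coefficient matrix $$\bar A=(\bar a_{ij})_{k\times k},\qquad \bar a_{ij}=b_j\sum_{l=0}^{n-1}\widehat P_l(c_j)\int_0^{c_i}\widehat P_l(\tau)\,d\tau,$$ and it is exactly the Hamiltonian Boundary Value Method HBVM($k,n$) (with the same nodes and weights) for the system $u'(t)=g(t,u(t))$, $u(0)=u_0$.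
   Context: Here $g:\mathbb R\times\mathbb R^d\to\mathbb R^d$ is analytic, $u_0\in\mathbb R^d$, and $A$ is a linear operator on $\mathbb R^d$ (a $d\times d$ matrix). The stepsize is $h>0$ and $V:=hA$. Shifted Legendre polynomials: $\widehat P_j(x)=(-1)^j\sqrt{2j+1}\sum_{i=0}^{j}\binom{j}{i}\binom{j+i}{i}(-x)^i$, so that $\int_0^1\widehat P_i\widehat P_j\,dx=\delta_{ij}$. $\varphi$-functions: $\varphi_0(z)=e^z$, $\varphi_i(z)=\int_0^1e^{(1-\sigma)z}\frac{\sigma^{i-1}}{(i-1)!}d\sigma$ for $i\ge1$. Let $0\le c_1\le\dots\le c_k\le1$ and $b_1,\dots,b_k$ be the nodes and weights of a quadrature formula on $[0,1]$ that is exact for polynomials of degree up to $m-1$, with $m\ge k$. EFCM($k,n$) (the $k$-stage exponential Fourier collocation method with integer $n$, $2\le n\le k$) is $$v_i=\varphi_0(-c_iV)u_0+c_ih\sum_{l=1}^kb_l\Big(\sum_{j=0}^{n-1}I_{j,c_i}(V)\widehat P_j(c_l)\Big)g(c_lh,v_l),\quad i=1,\dots,k,$$ $$v(h)=\varphi_0(-V)u_0+h\sum_{l=1}^kb_l\Big(\sum_{j=0}^{n-1}I_j(V)\widehat P_j(c_l)\Big)g(c_lh,v_l),$$ where $I_j(V)=\int_0^1\widehat P_j(z)e^{-(1-z)V}dz=\sqrt{2j+1}\sum_{i=0}^j(-1)^{j+i}\frac{(j+i)!}{i!(j-i)!}\varphi_{i+1}(-V)$ and $I_{j,c}(V)=\int_0^1\widehat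 P_j(cz)e^{-(1-z)cV}dz=(-1)^j\sqrt{2j+1}\sum_{i=0}^j(-c)^i\frac{(j+i)!}{i!(j-i)!}\varphi_{i+1}(-cV)$. HBVM($k,n$) for $u'=g(t,u)$, $u(0)=u_0$, with nodes $c_l$ and weights $b_l$: the approximation $\sigma(h)$, where $\sigma$ is the polynomial of degree at most $n$ with $\sigma(0)=u_0$ and $\sigma'(\xi h)=\sum_{j=0}^{n-1}\widehat P_j(\xi)\sum_{l=1}^kb_l\widehat P_j(c_l)g(c_lh,\sigma(c_lh))$ for $\xi\in[0,1]$; its stage values are $\sigma(c_ih)$. *)

theory Defs
  imports "HOL-Analysis.Analysis" "HOL-Computational_Algebra.Polynomial"
begin

text \<open>
  Power series expansion around every point; the index set consists of the multi-indices
  on the coordinates (the elements of \<open>Basis\<close>), extended by zero elsewhere.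
\<close>
definition real_analytic :: "('a::euclidean_space \<Rightarrow> 'b::euclidean_space) \<Rightarrow> bool" where
  "real_analytic f \<longleftrightarrow>
     (\<forall>x. \<exists>r>0. \<exists>a :: ('a \<Rightarrow> nat) \<Rightarrow> 'b. \<forall>y\<in>ball x r.
        ((\<lambda>\<alpha>. (\<Prod>e\<in>Basis. ((y - x) \<bullet> e) ^ \<alpha> e) *\<^sub>R a \<alpha>) has_sum f y)
          {\<alpha>. \<forall>e. e \<notin> Basis \<longrightarrow> \<alpha> e = 0})"

text \<open>
  The type of square matrices carries only the componentwise product, so neither \<open>exp\<close>
  nor \<open>^\<close> is available for matrix multiplication.
\<close>
definition mat_exp :: "real^'d^'d \<Rightarrow> real^'d^'d" where
  "mat_exp Z = (\<Sum>n. (1 / fact n) *\<^sub>R (((**) Z ^^ n) (mat 1)))"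

fun phi :: "nat \<Rightarrow> real^'d^'d \<Rightarrow> real^'d^'d" where
  "phi 0 Z = mat_exp Z"
| "phi (Suc i) Z = integral {0..1} (\<lambda>s. (s ^ i / fact i) *\<^sub>R mat_exp ((1 - s) *\<^sub>R Z))"

definition shifted_legendre :: "nat \<Rightarrow> real \<Rightarrow> real" where
  "shifted_legendre j x =
     (- 1) ^ j * sqrt (2 * real j + 1) *
     (\<Sum>i\<le>j. real (j choose i) * real ((j + i) choose i) * (- x) ^ i)"

definition quadrature_exact ::
  "nat \<Rightarrow> (nat \<Rightarrow> real) \<Rightarrow> (nat \<Rightarrow> real) \<Rightarrow> nat \<Rightarrow> bool" where
  "quadrature_exact k c b r \<longleftrightarrow>
     (\<forall>p :: real poly. degree p \<le> r \<longrightarrow>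
        (\<Sum>l=1..k. b l * poly p (c l)) = integral {0..1} (poly p))"

definition I_mat :: "nat \<Rightarrow> real^'d^'d \<Rightarrow> real^'d^'d" where
  "I_mat j V = integral {0..1} (\<lambda>z. shifted_legendre j z *\<^sub>R mat_exp ((- (1 - z)) *\<^sub>R V))"

definition Ic_mat :: "nat \<Rightarrow> real \<Rightarrow> real^'d^'d \<Rightarrow> real^'d^'d" where
  "Ic_mat j c V =
     integral {0..1} (\<lambda>z. shifted_legendre j (c * z) *\<^sub>R mat_exp ((- (1 - z) * c) *\<^sub>R V))"

definition I_tilde :: "nat \<Rightarrow> real \<Rightarrow> real" where
  "I_tilde j c = integral {0..1} (\<lambda>z. shifted_legendre j (c * z))"

definition efcm_stage_coeff ::
  "nat \<Rightarrow> (nat \<Rightarrow> real) \<Rightarrow> (nat \<Rightarrow> real) \<Rightarrow> nat \<Rightarrow> nat \<Rightarrow> real^'d^'d \<Rightarrow> real^'d^'d" where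
  "efcm_stage_coeff n c b i l V =
     b l *\<^sub>R (\<Sum>j<n. shifted_legendre j (c l) *\<^sub>R Ic_mat j (c i) V)"

definition efcm_final_coeff ::
  "nat \<Rightarrow> (nat \<Rightarrow> real) \<Rightarrow> (nat \<Rightarrow> real) \<Rightarrow> nat \<Rightarrow> real^'d^'d \<Rightarrow> real^'d^'d" where
  "efcm_final_coeff n c b l V =
     b l *\<^sub>R (\<Sum>j<n. shifted_legendre j (c l) *\<^sub>R I_mat j V)"

text \<open>
  The methods are implicit.  Each of them is rendered as the relation satisfied by the stage
  values \<open>v 1, \<dots>, v k\<close> and the numerical approximation \<open>w\<close> at time \<open>h\<close>.
\<close>
definition efcm ::
  "nat \<Rightarrow> nat \<Rightarrow> (nat \<Rightarrow> real) \<Rightarrow> (nat \<Rightarrow> real) \<Rightarrow> real \<Rightarrow> real^'d^'d \<Rightarrow>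
   (real \<Rightarrow> real^'d \<Rightarrow> real^'d) \<Rightarrow> real^'d \<Rightarrow> (nat \<Rightarrow> real^'d) \<Rightarrow> real^'d \<Rightarrow> bool" where
  "efcm k n c b h A g u0 v w \<longleftrightarrow>
     (\<forall>i\<in>{1..k}. v i = phi 0 ((- c i) *\<^sub>R (h *\<^sub>R A)) *v u0
        + (c i * h) *\<^sub>R (\<Sum>l=1..k. efcm_stage_coeff n c b i l (h *\<^sub>R A) *v g (c l * h) (v l)))
   \<and> w = phi 0 (- (h *\<^sub>R A)) *v u0
        + h *\<^sub>R (\<Sum>l=1..k. efcm_final_coeff n c b l (h *\<^sub>R A) *v g (c l * h) (v l))"

definition reduced_stage_coeff ::
  "nat \<Rightarrow> (nat \<Rightarrow> real) \<Rightarrow> (nat \<Rightarrow> real) \<Rightarrow> nat \<Rightarrow> nat \<Rightarrow> real" where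
  "reduced_stage_coeff n c b i l = b l * (\<Sum>j<n. I_tilde j (c i) * shifted_legendre j (c l))"

definition reduced_scheme ::
  "nat \<Rightarrow> nat \<Rightarrow> (nat \<Rightarrow> real) \<Rightarrow> (nat \<Rightarrow> real) \<Rightarrow> real \<Rightarrow>
   (real \<Rightarrow> real^'d \<Rightarrow> real^'d) \<Rightarrow> real^'d \<Rightarrow> (nat \<Rightarrow> real^'d) \<Rightarrow> real^'d \<Rightarrow> bool" where
  "reduced_scheme k n c b h g u0 v w \<longleftrightarrow>
     (\<forall>i\<in>{1..k}. v i = u0
        + (c i * h) *\<^sub>R (\<Sum>l=1..k. reduced_stage_coeff n c b i l *\<^sub>R g (c l * h) (v l)))
   \<and> w = u0 + h *\<^sub>R (\<Sum>l=1..k. b l *\<^sub>R g (c l * h) (v l))"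

definition runge_kutta ::
  "nat \<Rightarrow> (nat \<Rightarrow> real) \<Rightarrow> (nat \<Rightarrow> real) \<Rightarrow> (nat \<Rightarrow> nat \<Rightarrow> real) \<Rightarrow> real \<Rightarrow>
   (real \<Rightarrow> real^'d \<Rightarrow> real^'d) \<Rightarrow> real^'d \<Rightarrow> (nat \<Rightarrow> real^'d) \<Rightarrow> real^'d \<Rightarrow> bool" where
  "runge_kutta k c b a h g u0 v w \<longleftrightarrow>
     (\<forall>i\<in>{1..k}. v i = u0 + h *\<^sub>R (\<Sum>j=1..k. a i j *\<^sub>R g (c j * h) (v j)))
   \<and> w = u0 + h *\<^sub>R (\<Sum>j=1..k. b j *\<^sub>R g (c j * h) (v j))"

definition hbvm_polynomial ::
  "nat \<Rightarrow> nat \<Rightarrow> (nat \<Rightarrow> real) \<Rightarrow> (nat \<Rightarrow> real) \<Rightarrow> real \<Rightarrow>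
   (real \<Rightarrow> real^'d \<Rightarrow> real^'d) \<Rightarrow> real^'d \<Rightarrow> (real \<Rightarrow> real^'d) \<Rightarrow> bool" where
  "hbvm_polynomial k n c b h g u0 \<sigma> \<longleftrightarrow>
     (\<exists>a. \<sigma> = (\<lambda>t. \<Sum>i\<le>n. t ^ i *\<^sub>R a i))
   \<and> \<sigma> 0 = u0
   \<and> (\<forall>\<xi>\<in>{0..1}. (\<sigma> has_vector_derivative
        (\<Sum>j<n. shifted_legendre j \<xi> *\<^sub>R
           (\<Sum>l=1..k. (b l * shifted_legendre j (c l)) *\<^sub>R g (c l * h) (\<sigma> (c l * h)))))
        (at (\<xi> * h)))"

definition hbvm ::
  "nat \<Rightarrow> nat \<Rightarrow> (nat \<Rightarrow> real) \<Rightarrow> (nat \<Rightarrow> real) \<Rightarrow> real \<Rightarrow>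
   (real \<Rightarrow> real^'d \<Rightarrow> real^'d) \<Rightarrow> real^'d \<Rightarrow> (nat \<Rightarrow> real^'d) \<Rightarrow> real^'d \<Rightarrow> bool" where
  "hbvm k n c b h g u0 v w \<longleftrightarrow>
     (\<exists>\<sigma>. hbvm_polynomial k n c b h g u0 \<sigma> \<and> (\<forall>i\<in>{1..k}. v i = \<sigma> (c i * h)) \<and> w = \<sigma> h)"

end

theory Submission imports Defs begin

text \<open>
  Two facts carry the result.  First, every coefficient of the exponential method depends
  continuously on the matrix: the exponential series converges locally uniformly
  (\<open>continuous_on_mat_exp\<close>), and integrating a jointly continuous function over a compact
  interval preserves continuity in the parameter (\<open>continuous_on_Ic_mat\<close>).  The limits for
  \<open>A \<rightarrow> 0\<close> are therefore values at \<open>0\<close>, where every exponential is the identity matrix and only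
  integrals of Legendre polynomials remain.

  Secondly, each of the three limiting schemes is the same statement about the Legendre
  coefficients \<open>\<gamma>\<^sub>j = \<Sum>l. b\<^sub>l P\<^sub>j(c\<^sub>l) g(c\<^sub>l h, v\<^sub>l)\<close> of the right-hand side.  Write \<open>Q\<^sub>j\<close> for the
  primitive of \<open>P\<^sub>j\<close> that vanishes at \<open>0\<close>.  Then the stages are the values at \<open>\<xi> = c\<^sub>i\<close>, and the
  result the value at \<open>\<xi> = 1\<close>, of \<open>u0 + h \<Sum>j<n. Q\<^sub>j(\<xi>) \<gamma>\<^sub>j\<close>.  For the stages of the first two schemes
  this is the substitution \<open>c \<integral>\<^sub>0\<^sup>1 P\<^sub>j(c z) dz = \<integral>\<^sub>0\<^sup>c P\<^sub>j = Q\<^sub>j(c)\<close>; for the collocation polynomial it is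
  integration of its prescribed derivative.  At \<open>\<xi> = 1\<close> the orthogonality of \<open>P\<^sub>j\<close> to the
  constants, \<open>Q\<^sub>j(1) = \<delta>\<^sub>j\<^sub>0\<close>, leaves the plain quadrature sum \<open>u0 + h \<gamma>\<^sub>0\<close>.
\<close>

section \<open>The matrix exponential\<close>

lemma bounded_bilinear_matrix_mult:
  "bounded_bilinear ((**) :: real^'n^'m \<Rightarrow> real^'p^'n \<Rightarrow> real^'p^'m)"
proof -
  have "bilinear ((**) :: real^'n^'m \<Rightarrow> real^'p^'n \<Rightarrow> real^'p^'m)"
    unfolding bilinear_def
    by (auto intro!: linearI
        simp: matrix_add_ldistrib matrix_matrix_mult_def vec_eq_iff algebra_simps
          sum.distrib sum_distrib_left)
  then show ?thesis
    by (simp add: bilinear_conv_bounded_bilinear)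
qed

text \<open>
  The norm on matrices is submultiplicative only up to a constant \<open>K\<close>, which does not affect the
  convergence of the majorizing series \<open>\<Sum>n. (K r)\<^sup>n / n!\<close> on the ball of radius \<open>r\<close>.
\<close>
lemma continuous_on_mat_exp: "continuous_on S (mat_exp :: real^'d^'d \<Rightarrow> real^'d^'d)"
proof -
  let ?pow = "\<lambda>n (Z :: real^'d^'d). ((**) Z ^^ n) (mat 1 :: real^'d^'d)"
  obtain K where K: "K > 0" "\<And>(X :: real^'d^'d) (Y :: real^'d^'d). norm (X ** Y) \<le> norm X * norm Y * K"
    using bounded_bilinear.pos_bounded[OF bounded_bilinear_matrix_mult] by metis
  have norm_pow: "norm (?pow n Z) \<le> norm (mat 1 :: real^'d^'d) * (K * norm Z) ^ n" for n Z
  proof (induction n)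
    case (Suc n)
    have "norm (?pow (Suc n) Z) \<le> norm Z * norm (?pow n Z) * K"
      using K(2)[of Z "?pow n Z"] by simp
    also have "\<dots> \<le> norm Z * (norm (mat 1 :: real^'d^'d) * (K * norm Z) ^ n) * K"
      using Suc.IH K(1) by (intro mult_left_mono mult_right_mono) auto
    finally show ?case
      by (simp add: mult_ac)
  qed simp
  have cont_pow: "continuous_on T (?pow n)" for n T
    by (induction n)
      (auto intro!: bounded_bilinear.continuous_on[OF bounded_bilinear_matrix_mult]
        continuous_intros)
  have cont_ball: "continuous_on (ball 0 r) (mat_exp :: real^'d^'d \<Rightarrow> real^'d^'d)" for r
  proof -
    let ?M = "\<lambda>n. norm (mat 1 :: real^'d^'d) * (inverse (fact n) * (K * r) ^ n)"
    have bound: "norm ((1 / fact n) *\<^sub>R ?pow n Z) \<le> ?M n" if "Z \<in> ball 0 r" for n Z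
    proof -
      have "(K * norm Z) ^ n \<le> (K * r) ^ n"
        using that K(1) by (intro power_mono mult_left_mono) auto
      then have "norm (?pow n Z) \<le> norm (mat 1 :: real^'d^'d) * (K * r) ^ n"
        by (intro order_trans[OF norm_pow] mult_left_mono) auto
      then show ?thesis
        by (simp add: divide_simps mult_ac)
    qed
    have "uniform_limit (ball 0 r) (\<lambda>N Z. \<Sum>n<N. (1 / fact n) *\<^sub>R ?pow n Z)
        (\<lambda>Z. \<Sum>n. (1 / fact n) *\<^sub>R ?pow n Z) sequentially"
      by (rule Weierstrass_m_test[OF bound]) (auto intro!: summable_mult summable_exp)
    then have "continuous_on (ball 0 r) (\<lambda>Z. \<Sum>n. (1 / fact n) *\<^sub>R ?pow n Z)"
      by (rule uniform_limit_theorem[rotated])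
        (auto intro!: always_eventually continuous_on_sum continuous_on_scaleR
          continuous_on_const cont_pow)
    then show ?thesis
      by (simp add: mat_exp_def[abs_def])
  qed
  have "isCont (mat_exp :: real^'d^'d \<Rightarrow> real^'d^'d) Z" for Z
    using cont_ball[of "norm Z + 1"]
    by (rule continuous_on_interior) (simp add: interior_open)
  then show ?thesis
    by (simp add: continuous_at_imp_continuous_on)
qed

lemma mat_exp_0 [simp]: "mat_exp (0 :: real^'d^'d) = mat 1"
proof -
  have "((**) (0 :: real^'d^'d) ^^ n) (mat 1) = (if n = 0 then mat 1 else 0)" for n
    by (cases n) (auto simp: matrix_matrix_mult_def vec_eq_iff)
  then have "mat_exp (0 :: real^'d^'d) = (\<Sum>n. if n = 0 then mat 1 else 0)"
    unfolding mat_exp_def by (intro suminf_cong) auto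
  also have "\<dots> = mat 1"
    by (subst suminf_finite[of "{0}"]) auto
  finally show ?thesis .
qed

section \<open>Legendre polynomials and their primitives\<close>

text \<open>
  As an element of type \<open>real poly\<close> the primitive has a degree and coefficients, which the
  construction of the collocation polynomial uses.
\<close>
definition legendre_primitive :: "nat \<Rightarrow> real poly" where
  "legendre_primitive j = (\<Sum>i\<le>j. monom ((- 1) ^ j * sqrt (2 * real j + 1) *
     (real (j choose i) * real ((j + i) choose i) * (- 1) ^ i / real (Suc i))) (Suc i))"

lemma degree_legendre_primitive: "degree (legendre_primitive j) \<le> Suc j"
  unfolding legendre_primitive_def
  by (intro degree_sum_le) (auto intro: order_trans[OF degree_monom_le])

lemma poly_legendre_primitive_0 [simp]: "poly (legendre_primitive j) 0 = 0"
  by (simp add: legendre_primitive_def poly_sum poly_monom)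

lemma poly_pderiv_legendre_primitive [simp]:
  "poly (pderiv (legendre_primitive j)) x = shifted_legendre j x"
proof -
  have "poly (pderiv (legendre_primitive j)) x = (\<Sum>i\<le>j. (- 1) ^ j * sqrt (2 * real j + 1) *
      (real (j choose i) * real ((j + i) choose i) * (- 1) ^ i) * x ^ i)"
    unfolding legendre_primitive_def higher_pderiv_sum[where n = 1, simplified] poly_sum
    by (intro sum.cong) (simp_all add: pderiv_monom poly_monom divide_simps del: of_nat_Suc)
  also have "\<dots> = shifted_legendre j x"
    unfolding shifted_legendre_def sum_distrib_left
    by (intro sum.cong) (simp_all add: power_minus[of x] mult_ac)
  finally show ?thesis .
qed

lemma DERIV_legendre_primitive:
  "(poly (legendre_primitive j) has_real_derivative shifted_legendre j x) (at x within S)"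
  using has_field_derivative_at_within[OF poly_DERIV[of "legendre_primitive j" x]] by simp

lemma continuous_on_shifted_legendre [continuous_intros]:
  "continuous_on S f \<Longrightarrow> continuous_on S (\<lambda>x. shifted_legendre j (f x))"
  unfolding shifted_legendre_def by (intro continuous_intros)

lemma shifted_legendre_0 [simp]: "shifted_legendre 0 x = 1"
  by (simp add: shifted_legendre_def)

lemma integral_shifted_legendre:
  assumes "0 \<le> x"
  shows "integral {0..x} (shifted_legendre j) = poly (legendre_primitive j) x"
proof -
  have "(shifted_legendre j has_integral poly (legendre_primitive j) x - poly (legendre_primitive j) 0)
      {0..x}"
    using assms DERIV_legendre_primitive
    by (intro fundamental_theorem_of_calculus)
      (auto simp: has_real_derivative_iff_has_vector_derivative[symmetric])
  then show ?thesis
    by (simp add: integral_unique)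
qed

lemma mult_I_tilde: "x * I_tilde j x = poly (legendre_primitive j) x"
proof -
  have "((\<lambda>z. poly (legendre_primitive j) (x * z)) has_real_derivative
      shifted_legendre j (x * z) * x) (at z within {0..1})" for z
    using DERIV_chain2[OF DERIV_legendre_primitive, where g = "\<lambda>z. x * z" and Db = x]
    by (auto intro!: derivative_eq_intros)
  then have "((\<lambda>z. shifted_legendre j (x * z) * x) has_integral
      poly (legendre_primitive j) (x * 1) - poly (legendre_primitive j) (x * 0)) {0..1}"
    by (intro fundamental_theorem_of_calculus)
      (auto simp: has_real_derivative_iff_has_vector_derivative[symmetric])
  from integral_unique[OF this] show ?thesis
    by (simp add: I_tilde_def mult.commute)
qed

text \<open>
  The closed form of the partial sums mirrors Legendre's equation
  \<open>(x (1 - x) P\<^sub>j'(x))' = - j (j + 1) P\<^sub>j(x)\<close>: for \<open>j > 0\<close>, dividing the primitive of \<open>P\<^sub>j\<close> by \<open>x (1 - x)\<close> amounts to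
  taking partial sums of its coefficients, and the quotient is a multiple of \<open>P\<^sub>j'\<close>.
\<close>
lemma legendre_primitive_partial_sum:
  "real j * (real j + 1) *
     (\<Sum>i<m. real (j choose i) * real ((j + i) choose i) * (- 1) ^ i / real (Suc i))
   = - ((- 1) ^ m * real m * real (j choose m) * real ((j + m) choose m))"
proof (induction m)
  case (Suc m)
  define p where "p = real (j choose m)"
  define q where "q = real ((j + m) choose m)"
  define p' where "p' = real (j choose Suc m)"
  define q' where "q' = real ((j + Suc m) choose Suc m)"
  have p': "(real m + 1) * p' = (real j - real m) * p"
  proof (cases "m \<le> j")
    case True
    have "Suc m * (j choose Suc m) = (j - m) * (j choose m)"
      by (simp only: binomial_absorption binomial_absorb_comp)
    then have "real (Suc m * (j choose Suc m)) = real ((j - m) * (j choose m))"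
      by (rule arg_cong)
    then show ?thesis
      using True unfolding p_def p'_def of_nat_mult of_nat_diff[OF True] by (simp add: add.commute)
  qed (simp add: p_def p'_def binomial_eq_0)
  have "Suc m * ((j + Suc m) choose Suc m) = (j + Suc m) * ((j + m) choose m)"
    using Suc_times_binomial_eq[of "j + m" m] by (simp add: mult.commute)
  then have "real (Suc m * ((j + Suc m) choose Suc m)) = real ((j + Suc m) * ((j + m) choose m))"
    by (rule arg_cong)
  then have q': "(real m + 1) * q' = (real j + real m + 1) * q"
    unfolding q_def q'_def of_nat_mult by (simp add: add_ac)
  have "(real m + 1) * (real m * p * q + (real m + 1) * p' * q')
      = (real m + 1) * real m * p * q + ((real m + 1) * p') * ((real m + 1) * q')"
    by (simp add: algebra_simps)
  also have "\<dots> = real j * (real j + 1) * (p * q)"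
    unfolding p' q' by (simp add: algebra_simps)
  finally have numerator: "(real m + 1) * (real m * p * q + (real m + 1) * p' * q')
      = real j * (real j + 1) * (p * q)" .
  have "real j * (real j + 1) * (p * q * (- 1) ^ m / real (Suc m))
      = (- 1) ^ m * (real j * (real j + 1) * (p * q) / (real m + 1))"
    by (simp add: add.commute)
  also have "\<dots> = (- 1) ^ m * (real m * p * q + (real m + 1) * p' * q')"
    unfolding numerator[symmetric] by simp
  finally have step: "real j * (real j + 1) * (p * q * (- 1) ^ m / real (Suc m))
      = (- 1) ^ m * (real m * p * q + (real m + 1) * p' * q')" .
  have "real j * (real j + 1) *
      (\<Sum>i<Suc m. real (j choose i) * real ((j + i) choose i) * (- 1) ^ i / real (Suc i))
    = - ((- 1) ^ m * real m * p * q) + real j * (real j + 1) * (p * q * (- 1) ^ m / real (Suc m))"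
    using Suc.IH by (simp add: distrib_left p_def q_def)
  also have "\<dots> = - ((- 1) ^ Suc m * real (Suc m) * p' * q')"
    unfolding step by (simp add: algebra_simps)
  finally show ?case
    by (simp add: p'_def q'_def)
qed simp

lemma poly_legendre_primitive_1: "poly (legendre_primitive j) 1 = (if j = 0 then 1 else 0)"
proof (cases "j = 0")
  case False
  have "real j * (real j + 1) *
      (\<Sum>i\<le>j. real (j choose i) * real ((j + i) choose i) * (- 1) ^ i / real (Suc i)) = 0"
    using legendre_primitive_partial_sum[of j "Suc j"] unfolding lessThan_Suc_atMost by simp
  moreover have "real j * (real j + 1) \<noteq> 0"
    using False by simp
  ultimately have "(\<Sum>i\<le>j. real (j choose i) * real ((j + i) choose i) * (- 1) ^ i / real (Suc i)) = 0"
    by (simp only: mult_eq_0_iff) blast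
  then show ?thesis
    using False
    unfolding legendre_primitive_def poly_sum poly_monom power_one mult_1_right
      sum_distrib_left[symmetric]
    by simp
qed (simp add: legendre_primitive_def poly_monom)

section \<open>Continuity of the coefficients in the matrix\<close>

lemma continuous_on_Ic_mat: "continuous_on S (Ic_mat j c :: real^'d^'d \<Rightarrow> real^'d^'d)"
proof -
  have "continuous_on (S \<times> cbox 0 1) (\<lambda>(V :: real^'d^'d, z).
      shifted_legendre j (c * z) *\<^sub>R mat_exp ((- (1 - z) * c) *\<^sub>R V))"
    unfolding split_beta
    by (intro continuous_intros continuous_on_compose2[OF continuous_on_mat_exp[of UNIV]]) auto
  from integral_continuous_on_param[OF this] show ?thesis
    by (simp add: Ic_mat_def[abs_def])
qed

lemma Ic_mat_0 [simp]: "Ic_mat j c (0 :: real^'d^'d) = I_tilde j c *\<^sub>R mat 1"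
proof -
  have "(\<lambda>z. shifted_legendre j (c * z)) integrable_on {0..1}"
    by (intro integrable_continuous_real continuous_intros)
  then have "((\<lambda>z. shifted_legendre j (c * z) *\<^sub>R (mat 1 :: real^'d^'d)) has_integral
      I_tilde j c *\<^sub>R mat 1) {0..1}"
    unfolding I_tilde_def by (intro has_integral_scaleR_left integrable_integral)
  then show ?thesis
    by (simp add: Ic_mat_def integral_unique)
qed

lemma I_mat_eq_Ic_mat: "I_mat j = Ic_mat j 1"
  by (auto simp: I_mat_def Ic_mat_def)

lemma continuous_on_efcm_stage_coeff:
  "continuous_on S (efcm_stage_coeff n c b i l :: real^'d^'d \<Rightarrow> real^'d^'d)"
  unfolding efcm_stage_coeff_def[abs_def] by (intro continuous_intros continuous_on_Ic_mat)

lemma continuous_on_efcm_final_coeff: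
  "continuous_on S (efcm_final_coeff n c b l :: real^'d^'d \<Rightarrow> real^'d^'d)"
  unfolding efcm_final_coeff_def[abs_def] I_mat_eq_Ic_mat
  by (intro continuous_intros continuous_on_Ic_mat)

lemma efcm_stage_coeff_0:
  "efcm_stage_coeff n c b i l (0 :: real^'d^'d) = reduced_stage_coeff n c b i l *\<^sub>R mat 1"
  by (simp add: efcm_stage_coeff_def reduced_stage_coeff_def mult.commute
      flip: scaleR_left.sum)

text \<open>
  The integrals of \<open>P\<^sub>j\<close> over \<open>[0, 1]\<close> vanish for \<open>j > 0\<close>, so the inner sum collapses to its term
  \<open>j = 0\<close>, whose factor \<open>P\<^sub>0(c\<^sub>l)\<close> is \<open>1\<close>.
\<close>
lemma efcm_final_coeff_0:
  assumes "0 < n"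
  shows "efcm_final_coeff n c b l (0 :: real^'d^'d) = b l *\<^sub>R mat 1"
proof -
  have "I_tilde j 1 = (if j = 0 then 1 else 0)" for j
    using mult_I_tilde[of 1 j] by (simp add: poly_legendre_primitive_1)
  then have "efcm_final_coeff n c b l (0 :: real^'d^'d)
      = b l *\<^sub>R (\<Sum>j<n. if j = 0 then mat 1 else 0)"
    unfolding efcm_final_coeff_def I_mat_eq_Ic_mat Ic_mat_0
    by (intro arg_cong[where f = "(*\<^sub>R) (b l)"] sum.cong) auto
  then show ?thesis
    using assms by simp
qed

lemma tendsto_scaleR_at_0:
  fixes F :: "'a::real_normed_vector \<Rightarrow> 'b::topological_space"
  assumes "continuous_on UNIV F"
  shows "((\<lambda>x. F (r *\<^sub>R x)) \<longlongrightarrow> F 0) (at 0)"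
proof -
  have "continuous_on UNIV (\<lambda>x. F (r *\<^sub>R x))"
    by (rule continuous_on_compose2[OF assms]) (auto intro!: continuous_intros)
  then have "isCont (\<lambda>x. F (r *\<^sub>R x)) 0"
    by (simp add: continuous_on_eq_continuous_at)
  then show ?thesis
    by (simp add: isCont_def)
qed

section \<open>The common Legendre form of the limiting schemes\<close>

definition legendre_coeff ::
  "nat \<Rightarrow> (nat \<Rightarrow> real) \<Rightarrow> (nat \<Rightarrow> real) \<Rightarrow> real \<Rightarrow>
   (real \<Rightarrow> real^'d \<Rightarrow> real^'d) \<Rightarrow> (nat \<Rightarrow> real^'d) \<Rightarrow> nat \<Rightarrow> real^'d" where
  "legendre_coeff k c b h g v j =
     (\<Sum>l=1..k. (b l * shifted_legendre j (c l)) *\<^sub>R g (c l * h) (v l))"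

text \<open>
  If \<open>\<gamma>\<close> consists of the Legendre coefficients of the right-hand side, this is the HBVM collocation
  polynomial in the scaled variable \<open>\<xi> = t / h\<close>.
\<close>
definition legendre_solution ::
  "nat \<Rightarrow> real \<Rightarrow> real^'d \<Rightarrow> (nat \<Rightarrow> real^'d) \<Rightarrow> real \<Rightarrow> real^'d" where
  "legendre_solution n h u0 \<gamma> \<xi> = u0 + h *\<^sub>R (\<Sum>j<n. poly (legendre_primitive j) \<xi> *\<^sub>R \<gamma> j)"

lemma legendre_solution_0 [simp]: "legendre_solution n h u0 \<gamma> 0 = u0"
  by (simp add: legendre_solution_def)

lemma legendre_solution_1:
  assumes "0 < n"
  shows "legendre_solution n h u0 \<gamma> 1 = u0 + h *\<^sub>R \<gamma> 0"
proof -
  have "(\<Sum>j<n. poly (legendre_primitive j) 1 *\<^sub>R \<gamma> j) = (\<Sum>j<n. if j = 0 then \<gamma> 0 else 0)"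
    by (intro sum.cong) (auto simp: poly_legendre_primitive_1)
  then show ?thesis
    using assms by (simp add: legendre_solution_def)
qed

lemma has_vector_derivative_legendre_solution:
  "(legendre_solution n h u0 \<gamma> has_vector_derivative
      h *\<^sub>R (\<Sum>j<n. shifted_legendre j x *\<^sub>R \<gamma> j)) (at x within S)"
  unfolding legendre_solution_def[abs_def]
  by (auto intro!: derivative_eq_intros)

lemma sum_quadrature_eq_legendre_coeff:
  "(\<Sum>l=1..k. (b l * (\<Sum>j<n. q j * shifted_legendre j (c l))) *\<^sub>R g (c l * h) (v l))
   = (\<Sum>j<n. q j *\<^sub>R legendre_coeff k c b h g v j)"
  unfolding legendre_coeff_def scaleR_sum_right sum_distrib_left scaleR_left.sum
  by (subst sum.swap) (simp add: mult_ac)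

lemma reduced_scheme_iff_legendre_solution:
  assumes "0 < n"
  shows "reduced_scheme k n c b h g u0 v w \<longleftrightarrow>
    (\<forall>i\<in>{1..k}. v i = legendre_solution n h u0 (legendre_coeff k c b h g v) (c i)) \<and>
    w = legendre_solution n h u0 (legendre_coeff k c b h g v) 1"
proof -
  have stage_sum: "c i *\<^sub>R (\<Sum>l=1..k. reduced_stage_coeff n c b i l *\<^sub>R g (c l * h) (v l))
      = (\<Sum>j<n. poly (legendre_primitive j) (c i) *\<^sub>R legendre_coeff k c b h g v j)" for i
    unfolding reduced_stage_coeff_def sum_quadrature_eq_legendre_coeff[where g = g]
    by (simp add: scaleR_sum_right mult_I_tilde)
  have "(c i * h) *\<^sub>R (\<Sum>l=1..k. reduced_stage_coeff n c b i l *\<^sub>R g (c l * h) (v l))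
      = h *\<^sub>R (\<Sum>j<n. poly (legendre_primitive j) (c i) *\<^sub>R legendre_coeff k c b h g v j)" for i
    using arg_cong[OF stage_sum[of i], of "(*\<^sub>R) h"] by (simp only: scaleR_scaleR mult.commute[of h])
  moreover have "legendre_coeff k c b h g v 0 = (\<Sum>l=1..k. b l *\<^sub>R g (c l * h) (v l))"
    by (simp add: legendre_coeff_def)
  ultimately show ?thesis
    using assms
    by (simp add: reduced_scheme_def legendre_solution_1) (simp add: legendre_solution_def)
qed

lemma runge_kutta_iff_legendre_solution:
  assumes "0 < n" and "\<forall>i\<in>{1..k}. 0 \<le> c i"
  shows "runge_kutta k c b
      (\<lambda>i j. b j * (\<Sum>l<n. shifted_legendre l (c j) * integral {0..c i} (shifted_legendre l)))
      h g u0 v w \<longleftrightarrow>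
    (\<forall>i\<in>{1..k}. v i = legendre_solution n h u0 (legendre_coeff k c b h g v) (c i)) \<and>
    w = legendre_solution n h u0 (legendre_coeff k c b h g v) 1"
proof -
  have "(\<Sum>l=1..k. (b l * (\<Sum>j<n. shifted_legendre j (c l) * integral {0..c i} (shifted_legendre j)))
        *\<^sub>R g (c l * h) (v l))
      = (\<Sum>j<n. poly (legendre_primitive j) (c i) *\<^sub>R legendre_coeff k c b h g v j)"
    if "i \<in> {1..k}" for i
    using assms(2) that
    unfolding sum_quadrature_eq_legendre_coeff[symmetric]
    by (simp add: integral_shifted_legendre mult.commute)
  moreover have "legendre_coeff k c b h g v 0 = (\<Sum>l=1..k. b l *\<^sub>R g (c l * h) (v l))"
    by (simp add: legendre_coeff_def)
  ultimately show ?thesis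
    using assms(1)
    by (simp add: runge_kutta_def legendre_solution_1) (simp add: legendre_solution_def)
qed

text \<open>
  Both sides have the same derivative on \<open>[0, 1]\<close> as functions of \<open>\<xi>\<close> and agree at \<open>0\<close>.
\<close>
lemma hbvm_polynomial_eq_legendre_solution:
  assumes "hbvm_polynomial k n c b h g u0 \<sigma>" and "\<xi> \<in> {0..1}"
  shows "\<sigma> (\<xi> * h) = legendre_solution n h u0 (legendre_coeff k c b h g (\<lambda>l. \<sigma> (c l * h))) \<xi>"
proof -
  define \<gamma> where "\<gamma> = legendre_coeff k c b h g (\<lambda>l. \<sigma> (c l * h))"
  let ?d = "\<lambda>x. \<sigma> (x * h) - legendre_solution n h u0 \<gamma> x"
  have "(?d has_vector_derivative 0) (at x within {0..1})" if "x \<in> {0..1}" for x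
  proof -
    have "(\<sigma> has_vector_derivative (\<Sum>j<n. shifted_legendre j x *\<^sub>R \<gamma> j)) (at (x * h))"
      using assms(1) that by (simp add: hbvm_polynomial_def \<gamma>_def legendre_coeff_def)
    moreover have "((\<lambda>x. x * h) has_vector_derivative h) (at x)"
      by (auto intro!: derivative_eq_intros
          simp flip: has_real_derivative_iff_has_vector_derivative)
    ultimately have "((\<lambda>x. \<sigma> (x * h)) has_vector_derivative
        h *\<^sub>R (\<Sum>j<n. shifted_legendre j x *\<^sub>R \<gamma> j)) (at x)"
      using vector_diff_chain_at[of "\<lambda>x. x * h" h x \<sigma>] by (simp add: o_def)
    from has_vector_derivative_diff[OF has_vector_derivative_at_within[OF this]
        has_vector_derivative_legendre_solution[of n h u0 \<gamma>]]
    show ?thesis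
      by simp
  qed
  then obtain C where C: "\<And>x. x \<in> {0..1} \<Longrightarrow> ?d x = C"
    using has_vector_derivative_zero_constant[of "{0..1::real}" ?d] by auto
  have "?d \<xi> = ?d 0"
    using C[OF assms(2)] C[of 0] by simp
  also have "\<dots> = 0"
    using assms(1) by (simp add: hbvm_polynomial_def)
  finally show ?thesis
    by (simp add: \<gamma>_def)
qed

lemma legendre_solution_polynomial:
  "\<exists>a. (\<lambda>t. legendre_solution n h u0 \<gamma> (t / h)) = (\<lambda>t. \<Sum>i\<le>n. t ^ i *\<^sub>R a i)"
proof -
  have expand: "poly (legendre_primitive j) (t / h)
      = (\<Sum>i\<le>n. t ^ i * (coeff (legendre_primitive j) i / h ^ i))" if "j < n" for j t
  proof -
    have "degree (legendre_primitive j) \<le> n"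
      using degree_legendre_primitive[of j] that by linarith
    then have "poly (legendre_primitive j) (t / h)
        = poly (\<Sum>i\<le>n. monom (coeff (legendre_primitive j) i) i) (t / h)"
      by (simp only: poly_as_sum_of_monoms')
    then show ?thesis
      by (simp add: poly_sum poly_monom power_divide mult_ac)
  qed
  let ?a = "\<lambda>i. (if i = 0 then u0 else 0)
      + h *\<^sub>R (\<Sum>j<n. (coeff (legendre_primitive j) i / h ^ i) *\<^sub>R \<gamma> j)"
  have "legendre_solution n h u0 \<gamma> (t / h) = (\<Sum>i\<le>n. t ^ i *\<^sub>R ?a i)" for t
  proof -
    have "(\<Sum>j<n. poly (legendre_primitive j) (t / h) *\<^sub>R \<gamma> j)
        = (\<Sum>j<n. \<Sum>i\<le>n. t ^ i *\<^sub>R (coeff (legendre_primitive j) i / h ^ i) *\<^sub>R \<gamma> j)"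
      by (intro sum.cong) (auto simp: expand scaleR_left.sum)
    also have "\<dots> = (\<Sum>i\<le>n. t ^ i *\<^sub>R (\<Sum>j<n. (coeff (legendre_primitive j) i / h ^ i) *\<^sub>R \<gamma> j))"
      by (subst sum.swap) (simp add: scaleR_sum_right)
    finally have "legendre_solution n h u0 \<gamma> (t / h) = u0
        + h *\<^sub>R (\<Sum>i\<le>n. t ^ i *\<^sub>R (\<Sum>j<n. (coeff (legendre_primitive j) i / h ^ i) *\<^sub>R \<gamma> j))"
      by (simp add: legendre_solution_def)
    moreover have "(\<Sum>i\<le>n. t ^ i *\<^sub>R (if i = 0 then u0 else 0)) = u0"
    proof -
      have "(\<Sum>i\<le>n. t ^ i *\<^sub>R (if i = 0 then u0 else 0)) = (\<Sum>i\<le>n. if i = 0 then u0 else 0)"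
        by (intro sum.cong) auto
      then show ?thesis
        by simp
    qed
    ultimately show ?thesis
      by (simp add: scaleR_add_right sum.distrib scaleR_sum_right mult_ac)
  qed
  then show ?thesis
    by (intro exI[of _ ?a] ext)
qed

text \<open>
  The coefficients \<open>\<gamma>\<^sub>j\<close> see a collocation polynomial only through its values at the nodes, which are
  the stage values.  Given the stages, \<open>\<gamma>\<^sub>j\<close> is therefore known and \<open>legendre_solution\<close> rescaled to
  \<open>[0, h]\<close> serves as witness.
\<close>
lemma hbvm_iff_legendre_solution:
  fixes g :: "real \<Rightarrow> real^'d \<Rightarrow> real^'d"
  assumes "0 < h" and "\<forall>i\<in>{1..k}. 0 \<le> c i \<and> c i \<le> 1"
  shows "hbvm k n c b h g u0 v w \<longleftrightarrow>
    (\<forall>i\<in>{1..k}. v i = legendre_solution n h u0 (legendre_coeff k c b h g v) (c i)) \<and>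
    w = legendre_solution n h u0 (legendre_coeff k c b h g v) 1"
proof
  assume "hbvm k n c b h g u0 v w"
  then obtain \<sigma> where \<sigma>: "hbvm_polynomial k n c b h g u0 \<sigma>"
    and v: "\<forall>i\<in>{1..k}. v i = \<sigma> (c i * h)" and w: "w = \<sigma> h"
    unfolding hbvm_def by blast
  have "legendre_coeff k c b h g (\<lambda>l. \<sigma> (c l * h)) = legendre_coeff k c b h g v"
    using v by (auto simp: legendre_coeff_def)
  then have "\<sigma> (\<xi> * h) = legendre_solution n h u0 (legendre_coeff k c b h g v) \<xi>"
    if "\<xi> \<in> {0..1}" for \<xi>
    using hbvm_polynomial_eq_legendre_solution[OF \<sigma> that] by simp
  from this[of 1] this[of "c _"]
  show "(\<forall>i\<in>{1..k}. v i = legendre_solution n h u0 (legendre_coeff k c b h g v) (c i)) \<and>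
      w = legendre_solution n h u0 (legendre_coeff k c b h g v) 1"
    using v w assms(2) by simp
next
  define \<gamma> where "\<gamma> = legendre_coeff k c b h g v"
  assume "(\<forall>i\<in>{1..k}. v i = legendre_solution n h u0 (legendre_coeff k c b h g v) (c i)) \<and>
    w = legendre_solution n h u0 (legendre_coeff k c b h g v) 1"
  then have v: "\<forall>i\<in>{1..k}. v i = legendre_solution n h u0 \<gamma> (c i)"
    and w: "w = legendre_solution n h u0 \<gamma> 1"
    by (auto simp: \<gamma>_def)
  define \<sigma> where "\<sigma> = (\<lambda>t. legendre_solution n h u0 \<gamma> (t / h))"
  have \<sigma>_scaled: "\<sigma> (x * h) = legendre_solution n h u0 \<gamma> x" for x
    using assms(1) by (simp add: \<sigma>_def)
  have \<gamma>: "(\<Sum>l=1..k. (b l * shifted_legendre j (c l)) *\<^sub>R g (c l * h) (\<sigma> (c l * h))) = \<gamma> j" for j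
    using v by (auto simp: \<gamma>_def legendre_coeff_def \<sigma>_scaled)
  have "(\<sigma> has_vector_derivative (\<Sum>j<n. shifted_legendre j x *\<^sub>R \<gamma> j)) (at (x * h))" for x
  proof -
    have "((\<lambda>t. t / h) has_vector_derivative 1 / h) (at (x * h))"
      using assms(1)
      by (auto intro!: derivative_eq_intros
          simp flip: has_real_derivative_iff_has_vector_derivative)
    from vector_diff_chain_at[OF this has_vector_derivative_legendre_solution[of n h u0 \<gamma>]]
    show ?thesis
      using assms(1) by (simp add: \<sigma>_def o_def)
  qed
  then have "hbvm_polynomial k n c b h g u0 \<sigma>"
    using legendre_solution_polynomial[of n h u0 \<gamma>]
    unfolding hbvm_polynomial_def \<gamma> by (simp add: \<sigma>_def)
  moreover have "\<forall>i\<in>{1..k}. v i = \<sigma> (c i * h)" and "w = \<sigma> h"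
    using v w \<sigma>_scaled \<sigma>_scaled[of 1] by auto
  ultimately show "hbvm k n c b h g u0 v w"
    unfolding hbvm_def by blast
qed

section \<open>Reduction of the exponential method\<close>

lemma scaleR_mat_1_mult_vec: "(r *\<^sub>R mat 1) *v x = r *\<^sub>R x" for x :: "real^'d"
  by (simp flip: scaleR_matrix_vector_assoc)

lemma efcm_0_iff_reduced_scheme:
  fixes u0 :: "real^'d"
  assumes "0 < n"
  shows "efcm k n c b h 0 g u0 v w \<longleftrightarrow> reduced_scheme k n c b h g u0 v w"
  using assms
  by (simp add: efcm_def reduced_scheme_def efcm_stage_coeff_0 efcm_final_coeff_0
      scaleR_mat_1_mult_vec)

theorem theorem3p1:
  fixes k n m :: nat and b c :: "nat \<Rightarrow> real" and h :: real
    and g :: "real \<Rightarrow> real^'d \<Rightarrow> real^'d" and u0 :: "real^'d"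
  assumes "2 \<le> n" and "n \<le> k" and "k \<le> m" and "0 < h"
    and "real_analytic (\<lambda>(t, u). g t u)"
    and "\<forall>i\<in>{1..k}. 0 \<le> c i \<and> c i \<le> 1"
    and "\<forall>i\<in>{1..k}. \<forall>j\<in>{1..k}. i \<le> j \<longrightarrow> c i \<le> c j"
    and "quadrature_exact k c b (m - 1)"
  shows "(\<forall>i\<in>{1..k}. ((\<lambda>A :: real^'d^'d. phi 0 ((- c i) *\<^sub>R (h *\<^sub>R A))) \<longlongrightarrow> mat 1) (at 0))
    \<and> (\<forall>i\<in>{1..k}. \<forall>l\<in>{1..k}. ((\<lambda>A :: real^'d^'d. efcm_stage_coeff n c b i l (h *\<^sub>R A))
          \<longlongrightarrow> reduced_stage_coeff n c b i l *\<^sub>R mat 1) (at 0))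
    \<and> ((\<lambda>A :: real^'d^'d. phi 0 (- (h *\<^sub>R A))) \<longlongrightarrow> mat 1) (at 0)
    \<and> (\<forall>l\<in>{1..k}. ((\<lambda>A :: real^'d^'d. efcm_final_coeff n c b l (h *\<^sub>R A))
          \<longlongrightarrow> b l *\<^sub>R mat 1) (at 0))
    \<and> (\<forall>v w. efcm k n c b h 0 g u0 v w \<longleftrightarrow> reduced_scheme k n c b h g u0 v w)
    \<and> (\<forall>v w. reduced_scheme k n c b h g u0 v w \<longleftrightarrow>
          runge_kutta k c b
            (\<lambda>i j. b j * (\<Sum>l<n. shifted_legendre l (c j) * integral {0..c i} (shifted_legendre l)))
            h g u0 v w)
    \<and> (\<forall>v w. reduced_scheme k n c b h g u0 v w \<longleftrightarrow> hbvm k n c b h g u0 v w)"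
proof -
  have n: "0 < n"
    using assms(1) by simp
  have exp: "((\<lambda>A :: real^'d^'d. phi 0 (r *\<^sub>R A)) \<longlongrightarrow> mat 1) (at 0)" for r
    using tendsto_scaleR_at_0[OF continuous_on_mat_exp, of r] by simp
  have stage: "((\<lambda>A :: real^'d^'d. efcm_stage_coeff n c b i l (h *\<^sub>R A))
      \<longlongrightarrow> reduced_stage_coeff n c b i l *\<^sub>R mat 1) (at 0)" for i l
    using tendsto_scaleR_at_0[OF continuous_on_efcm_stage_coeff[of UNIV n c b i l], of h]
    by (simp add: efcm_stage_coeff_0)
  have final: "((\<lambda>A :: real^'d^'d. efcm_final_coeff n c b l (h *\<^sub>R A)) \<longlongrightarrow> b l *\<^sub>R mat 1) (at 0)" for l
    using tendsto_scaleR_at_0[OF continuous_on_efcm_final_coeff[of UNIV n c b l], of h]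
    by (simp add: efcm_final_coeff_0[OF n])
  have nodes: "\<forall>i\<in>{1..k}. 0 \<le> c i"
    using assms(6) by blast
  show ?thesis
    using exp[of "- c _ * h"] exp[of "- h"] stage final
    by (simp add: efcm_0_iff_reduced_scheme[OF n] reduced_scheme_iff_legendre_solution[OF n]
        runge_kutta_iff_legendre_solution[OF n nodes]
        hbvm_iff_legendre_solution[OF assms(4) assms(6)])
qed

end
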